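(* Let $G$ be finite and let $\mathbb{K}=(G,M,I)$ be a formal context with object set $G$. Then the generalised Tukey depth $T$ is weakly free with respect to the family $\mathscr{P}$ of all probability measures on $G$ and with respect to the quasiconcavity property (P7ii).
   Context: A formal context is a triple $\mathbb{K}=(G,M,I)$ with object set $G$, attribute set $M$ and a binary relation $I\subseteq G\times M$. For $A\subseteq G$ put $\Psi(A)=\{m\in M\mid \forall g\in A:(g,m)\in I\}$, and for $B\subseteq M$ put $\Phi(B)=\{g\in G\mid\forall m\in B:(g,m)\in I\}$ (so $\Psi(\emptyset)=M$, $\Phi(\emptyset)=G$). Then $\gamma=\Phi\circ\Psi$ is a closure operator on $2^G$. $\mathscr{P}$ is the set of all probability measures on the power set of the finite set $G$. A depth function on $\mathbb{K}$ is a function assigning to each $g\in G$ and $\Pr\in\mathscr{P}$ a value $D(g,\mathbb{K},\Pr)\in\mathbb{R}_{\ge0}$. The generalised Tukey depth is $T(g,\mathbb{K},\Pr)=1-\sup_{m\in M\setminus\Psi(\{g\})}\Pr(\Phi(\{m\}))$, with the convention that a supremum over the empty index set equals $0$. (P7ii) Quasiconcavity: a depth function $D$ on $\mathbb{K}$ is quasiconcave if for all $\Pr\in\mathscr{P}$, all nonempty $A\subseteq G$ and all $g\in\gamma(A)\setminus A$: $D(g,\mathbb{K},\Pr)\ge\inf_{\tilde g\in A}D(\tilde g,\mathbb{K},\Pr)$. Weakly free: $D$ is weakly free with respect to $\mathscr{P}$ and quasiconcavity if $D$ is quasiconcave and for every probability measure $\Pr\in\mathscr{P}$ and every quasiconcave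 depth function $E$ on $\mathbb{K}$ there exist $\tilde{\Pr}\in\mathscr{P}$ and an isotone (i.e. order preserving, nondecreasing) function $f:\mathbb{R}\to\mathbb{R}$ such that $f\circ D(\cdot,\mathbb{K},\tilde{\Pr})\cong E(\cdot,\mathbb{K},\Pr)$. Here, for $u,v:G\to\mathbb{R}$, $u\cong v$ (isomorphic) means that there exists a bijective and bimeasurable function $i:G\to G$ with $u(g)\le u(\tilde g)\iff v(i(g))\le v(i(\tilde g))$ for all $g,\tilde g\in G$ (bimeasurability being automatic here). *)

theory Defs
  imports "HOL-Probability.Probability_Measure"
begin

record ('g, 'm) formal_context =
  objects :: "'g set"
  attributes :: "'m set"
  incidence :: "('g \<times> 'm) set"

definition is_formal_context :: "('g, 'm) formal_context \<Rightarrow> bool" where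
  "is_formal_context K \<longleftrightarrow> incidence K \<subseteq> objects K \<times> attributes K"

text \<open>The derivation operators \<open>\<Psi>\<close> (\<open>common_attributes\<close>) and \<open>\<Phi>\<close> (\<open>common_objects\<close>), and \<open>\<gamma> = \<Phi> \<circ> \<Psi>\<close>.\<close>

definition common_attributes :: "('g, 'm) formal_context \<Rightarrow> 'g set \<Rightarrow> 'm set" where
  "common_attributes K A = {m \<in> attributes K. \<forall>g\<in>A. (g, m) \<in> incidence K}"

definition common_objects :: "('g, 'm) formal_context \<Rightarrow> 'm set \<Rightarrow> 'g set" where
  "common_objects K B = {g \<in> objects K. \<forall>m\<in>B. (g, m) \<in> incidence K}"

definition object_closure :: "('g, 'm) formal_context \<Rightarrow> 'g set \<Rightarrow> 'g set" where
  "object_closure K = common_objects K \<circ> common_attributes K"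

definition prob_measures :: "'g set \<Rightarrow> 'g measure set" where
  "prob_measures G = {P. prob_space P \<and> space P = G \<and> sets P = Pow G}"

text \<open>A depth function on a fixed context \<open>K\<close> maps an object and a probability measure to a
  nonnegative real. Its values for other arguments are irrelevant.\<close>

type_synonym 'g depth = "'g \<Rightarrow> 'g measure \<Rightarrow> real"

definition depth_function :: "('g, 'm) formal_context \<Rightarrow> 'g depth \<Rightarrow> bool" where
  "depth_function K D \<longleftrightarrow> (\<forall>g\<in>objects K. \<forall>P\<in>prob_measures (objects K). 0 \<le> D g P)"

text \<open>The case distinction is needed because \<open>Sup {}\<close> is unspecified on the reals.\<close>

definition tukey_depth :: "('g, 'm) formal_context \<Rightarrow> 'g depth" where
  "tukey_depth K g P =
     1 - (if attributes K - common_attributes K {g} = {} then 0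
          else SUP m\<in>attributes K - common_attributes K {g}. measure P (common_objects K {m}))"

definition quasiconcave :: "('g, 'm) formal_context \<Rightarrow> 'g depth \<Rightarrow> bool" where
  "quasiconcave K D \<longleftrightarrow>
     (\<forall>P\<in>prob_measures (objects K). \<forall>A. A \<noteq> {} \<and> A \<subseteq> objects K \<longrightarrow>
        (\<forall>g\<in>object_closure K A - A. (INF h\<in>A. D h P) \<le> D g P))"

text \<open>Measurability refers to the power set \<open>\<sigma>\<close>-algebra on \<open>G\<close>, i.e. that of \<open>count_space G\<close>.\<close>

definition isomorphic_on :: "'g set \<Rightarrow> ('g \<Rightarrow> real) \<Rightarrow> ('g \<Rightarrow> real) \<Rightarrow> bool" where
  "isomorphic_on G u v \<longleftrightarrow>
     (\<exists>i. bij_betw i G G \<and>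
          i \<in> measurable (count_space G) (count_space G) \<and>
          the_inv_into G i \<in> measurable (count_space G) (count_space G) \<and>
          (\<forall>g\<in>G. \<forall>h\<in>G. u g \<le> u h \<longleftrightarrow> v (i g) \<le> v (i h)))"

definition weakly_free ::
  "('g, 'm) formal_context \<Rightarrow> 'g measure set \<Rightarrow> ('g depth \<Rightarrow> bool) \<Rightarrow> 'g depth \<Rightarrow> bool" where
  "weakly_free K \<P> Q D \<longleftrightarrow>
     depth_function K D \<and> Q D \<and>
     (\<forall>P\<in>\<P>. \<forall>E. depth_function K E \<and> Q E \<longrightarrow>
        (\<exists>P'\<in>\<P>. \<exists>f :: real \<Rightarrow> real. mono f \<and>
           isomorphic_on (objects K) (\<lambda>g. f (D g P')) (\<lambda>g. E g P)))"

end

theory Submission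
  imports Defs
begin

text \<open>Write \<open>e = E(\<cdot>, \<K>, P)\<close> for the depth that is to be reproduced. Quasiconcavity of \<open>e\<close>
  means that its superlevel sets are closed, so every object outside a superlevel set \<open>L\<close> is
  separated from \<open>L\<close> by a single attribute \<open>m\<close>: \<open>L \<subseteq> \<Phi> {m}\<close>. Hence the Tukey depth outside \<open>L\<close>
  is at most \<open>1 - P' L\<close>, for any probability measure \<open>P'\<close>. On the other hand the Tukey depth of
  an object \<open>h\<close> never falls below \<open>P' {h}\<close>, because an attribute that \<open>h\<close> lacks has an extent
  that misses \<open>h\<close>.

  So it suffices to choose \<open>P'\<close> such that each single object \<open>h\<close> outweighs all objects with a
  strictly smaller value of \<open>e\<close> together (\<open>ex_dominating_prob_measure\<close>; weights growing
  geometrically along the levels of \<open>e\<close> do this). With \<open>L = {x. e x \<ge> e h}\<close> the two bounds then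
  say that \<open>e g < e h\<close> implies \<open>T g < T h\<close> (\<open>tukey_depth_refines\<close>). Consequently \<open>e\<close> is an
  isotone function of the Tukey depth for \<open>P'\<close>, and the identity serves as the isomorphism.
  The same description of the Tukey depth by separating attributes shows that it is itself
  quasiconcave.\<close>

lemma common_objects_event:
  assumes "P \<in> prob_measures (objects K)"
  shows "common_objects K B \<in> sets P"
  using assms by (auto simp: prob_measures_def common_objects_def)

lemma tukey_depth_le:
  assumes P: "P \<in> prob_measures (objects K)"
    and m: "m \<in> attributes K" "(g, m) \<notin> incidence K"
  shows "tukey_depth K g P \<le> 1 - measure P (common_objects K {m})"
proof -
  interpret prob_space P using P by (simp add: prob_measures_def)
  have m': "m \<in> attributes K - common_attributes K {g}"
    using m by (simp add: common_attributes_def)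
  have "bdd_above ((\<lambda>m. prob (common_objects K {m})) ` (attributes K - common_attributes K {g}))"
    by (rule bdd_aboveI[of _ 1]) auto
  then have "prob (common_objects K {m})
      \<le> (SUP m\<in>attributes K - common_attributes K {g}. prob (common_objects K {m}))"
    using m' by (rule cSUP_upper2) simp
  moreover have "attributes K - common_attributes K {g} \<noteq> {}"
    using m' by blast
  ultimately show ?thesis
    by (simp only: tukey_depth_def if_False)
qed

lemma tukey_depth_ge:
  assumes "c \<le> 1"
    and "\<And>m. \<lbrakk>m \<in> attributes K; (g, m) \<notin> incidence K\<rbrakk>
           \<Longrightarrow> measure P (common_objects K {m}) \<le> 1 - c"
  shows "c \<le> tukey_depth K g P"
proof (cases "attributes K - common_attributes K {g} = {}")
  case True
  then show ?thesis using assms(1) by (simp add: tukey_depth_def)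
next
  case False
  then have "(SUP m\<in>attributes K - common_attributes K {g}. measure P (common_objects K {m})) \<le> 1 - c"
    by (rule cSUP_least) (use assms(2) in \<open>auto simp: common_attributes_def\<close>)
  then show ?thesis using False by (simp only: tukey_depth_def if_False)
qed

lemma tukey_depth_nonneg:
  assumes "P \<in> prob_measures (objects K)"
  shows "0 \<le> tukey_depth K g P"
proof -
  interpret prob_space P using assms by (simp add: prob_measures_def)
  show ?thesis by (rule tukey_depth_ge) auto
qed

lemma tukey_depth_le_1:
  assumes "P \<in> prob_measures (objects K)"
  shows "tukey_depth K g P \<le> 1"
proof (cases "attributes K - common_attributes K {g} = {}")
  case True
  then show ?thesis by (simp add: tukey_depth_def)
next
  case False
  then obtain m where "m \<in> attributes K" "(g, m) \<notin> incidence K"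
    by (auto simp: common_attributes_def)
  from tukey_depth_le[OF assms this] show ?thesis
    using measure_nonneg[of P "common_objects K {m}"] by linarith
qed

text \<open>An attribute that \<open>h\<close> lacks has its extent inside the complement of \<open>{h}\<close>.\<close>

lemma prob_singleton_le_tukey_depth:
  assumes P: "P \<in> prob_measures (objects K)" and h: "h \<in> objects K"
  shows "measure P {h} \<le> tukey_depth K h P"
proof -
  interpret prob_space P using P by (simp add: prob_measures_def)
  have h': "{h} \<in> events" and sp: "space P = objects K"
    using P h by (auto simp: prob_measures_def)
  show ?thesis
  proof (rule tukey_depth_ge)
    fix m assume "(h, m) \<notin> incidence K"
    then have "common_objects K {m} \<subseteq> space P - {h}"
      by (auto simp: common_objects_def sp)
    then have "prob (common_objects K {m}) \<le> prob (space P - {h})"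
      using h' by (intro finite_measure_mono) auto
    then show "prob (common_objects K {m}) \<le> 1 - prob {h}"
      using h' by (simp add: prob_compl)
  qed simp
qed

text \<open>An attribute that an object of \<open>\<gamma> A\<close> lacks is already lacking from some member of \<open>A\<close>, so
  the supremum that defines its depth is dominated by those of the members of \<open>A\<close>.\<close>

lemma quasiconcave_tukey_depth: "quasiconcave K (tukey_depth K)"
  unfolding quasiconcave_def
proof (intro ballI allI impI)
  fix P A g
  assume P: "P \<in> prob_measures (objects K)"
    and A: "A \<noteq> {} \<and> A \<subseteq> objects K"
    and g: "g \<in> object_closure K A - A"
  have bdd: "bdd_below ((\<lambda>h. tukey_depth K h P) ` A)"
    by (rule bdd_belowI[of _ 0]) (auto simp: tukey_depth_nonneg[OF P])
  have INF_le: "(INF h\<in>A. tukey_depth K h P) \<le> tukey_depth K a P" if "a \<in> A" for a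
    using bdd that by (rule cINF_lower)
  show "(INF h\<in>A. tukey_depth K h P) \<le> tukey_depth K g P"
  proof (rule tukey_depth_ge)
    show "(INF h\<in>A. tukey_depth K h P) \<le> 1"
      using A INF_le tukey_depth_le_1[OF P] by (meson all_not_in_conv order_trans)
  next
    fix m assume m: "m \<in> attributes K" "(g, m) \<notin> incidence K"
    then obtain a where "a \<in> A" "(a, m) \<notin> incidence K"
      using g by (auto simp: object_closure_def common_objects_def common_attributes_def)
    then show "measure P (common_objects K {m}) \<le> 1 - (INF h\<in>A. tukey_depth K h P)"
      using tukey_depth_le[OF P m(1)] INF_le by fastforce
  qed
qed

text \<open>The infimum of the depth over a superlevel set is at least its threshold, so quasiconcavity
  puts every object of the closure above the threshold again.\<close>

lemma quasiconcave_superlevel_closed: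
  assumes E: "quasiconcave K E" and P: "P \<in> prob_measures (objects K)"
    and h: "h \<in> objects K"
  shows "object_closure K {x \<in> objects K. E h P \<le> E x P} \<subseteq> {x \<in> objects K. E h P \<le> E x P}"
    (is "object_closure K ?L \<subseteq> ?L")
proof
  fix g assume g: "g \<in> object_closure K ?L"
  show "g \<in> ?L"
  proof (rule ccontr)
    assume ng: "g \<notin> ?L"
    have L: "?L \<noteq> {} \<and> ?L \<subseteq> objects K" using h by blast
    then have "?L \<noteq> {}" ..
    then have "E h P \<le> (INF x\<in>?L. E x P)"
      by (rule cINF_greatest) simp
    also have "\<dots> \<le> E g P"
      by (rule E[unfolded quasiconcave_def, rule_format, OF P L DiffI[OF g ng]])
    finally show False
      using g ng by (simp add: object_closure_def common_objects_def)
  qed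
qed

text \<open>The weight of \<open>h\<close> is \<open>(n + 1) ^ r h\<close> up to normalisation, where \<open>n = card G\<close> and \<open>r\<close> increases
  strictly with \<open>e\<close>. There are at most \<open>n\<close> objects strictly below \<open>h\<close>, each lighter than \<open>h\<close> by
  a factor of at least \<open>n + 1\<close>, so together they still weigh less than \<open>h\<close>.\<close>

lemma ex_dominating_prob_measure:
  fixes e :: "'g \<Rightarrow> 'a::linorder"
  assumes fin: "finite G" and ne: "G \<noteq> {}"
  obtains P where "P \<in> prob_measures G"
    and "\<And>h. h \<in> G \<Longrightarrow> measure P {x\<in>G. e x < e h} < measure P {h}"
proof -
  define r where "r h = card {x\<in>G. e x < e h}" for h
  define w where "w h = (real (card G) + 1) ^ r h" for h
  define s where "s = sum w G"
  define P where "P = point_measure G (\<lambda>g. ennreal (w g / s))"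
  have w_pos: "0 < w h" for h
    unfolding w_def by (intro zero_less_power) simp
  have s_pos: "0 < s"
    unfolding s_def using fin ne w_pos by (intro sum_pos) auto
  have w_nonneg: "0 \<le> w x / s" for x
    using w_pos[of x] s_pos by simp
  have measure_P: "measure P A = sum w A / s" if "A \<subseteq> G" for A
    unfolding P_def using fin that w_nonneg
    by (simp add: measure_point_measure_finite_if sum_divide_distrib)
  have "(\<Sum>x\<in>G. w x / s) = 1"
    using s_pos by (simp add: s_def flip: sum_divide_distrib)
  then have "prob_space P"
    unfolding P_def using fin w_nonneg by (intro prob_space_point_measure) simp_all
  then have "P \<in> prob_measures G"
    by (simp add: prob_measures_def P_def space_point_measure sets_point_measure)
  moreover have "measure P {x\<in>G. e x < e h} < measure P {h}" if h: "h \<in> G" for h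
  proof -
    have r_less: "r x < r h" if "x \<in> G" "e x < e h" for x
      unfolding r_def using that fin by (intro psubset_card_mono) auto
    have "sum w {x\<in>G. e x < e h} < w h"
    proof (cases "r h")
      case 0
      then have "{x\<in>G. e x < e h} = {}" using r_less by auto
      then show ?thesis using w_pos[of h] by (simp only: sum.empty)
    next
      case (Suc k)
      have "sum w {x\<in>G. e x < e h} \<le> (\<Sum>x\<in>{x\<in>G. e x < e h}. (real (card G) + 1) ^ k)"
      proof (rule sum_mono)
        fix x assume "x \<in> {x\<in>G. e x < e h}"
        then have "r x \<le> k" using r_less[of x] Suc by simp
        then show "w x \<le> (real (card G) + 1) ^ k"
          unfolding w_def by (intro power_increasing) simp_all
      qed
      also have "\<dots> = real (card {x\<in>G. e x < e h}) * (real (card G) + 1) ^ k"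
        by simp
      also have "\<dots> \<le> real (card G) * (real (card G) + 1) ^ k"
        using fin by (intro mult_right_mono) (auto intro: card_mono)
      also have "\<dots> < w h"
        by (simp add: w_def Suc)
      finally show ?thesis .
    qed
    then show ?thesis
      using h s_pos by (simp add: measure_P divide_strict_right_mono)
  qed
  ultimately show thesis by (rule that)
qed

text \<open>The strict gap between the two depths is the domination inequality: the complement of the
  superlevel set at \<open>h\<close> bounds the depth of \<open>g\<close> from above, the weight of \<open>h\<close> bounds the depth
  of \<open>h\<close> from below.\<close>

lemma tukey_depth_refines:
  assumes E: "quasiconcave K E" and P: "P \<in> prob_measures (objects K)"
    and P': "P' \<in> prob_measures (objects K)"
    and dom: "measure P' {x \<in> objects K. E x P < E h P} < measure P' {h}"
    and gh: "g \<in> objects K" "h \<in> objects K" "E g P < E h P"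
  shows "tukey_depth K g P' < tukey_depth K h P'"
proof -
  interpret P': prob_space P' using P' by (simp add: prob_measures_def)
  have sp: "space P' = objects K" and ev: "sets P' = Pow (objects K)"
    using P' by (auto simp: prob_measures_def)
  let ?L = "{x \<in> objects K. E h P \<le> E x P}"
  have "g \<notin> object_closure K ?L"
    using quasiconcave_superlevel_closed[OF E P gh(2)] gh(3) by force
  then obtain m where m: "m \<in> attributes K" "(g, m) \<notin> incidence K"
    and L: "?L \<subseteq> common_objects K {m}"
    using gh(1) by (auto simp: object_closure_def common_objects_def common_attributes_def)
  have "tukey_depth K g P' \<le> 1 - measure P' (common_objects K {m})"
    by (rule tukey_depth_le[OF P' m])
  also have "\<dots> \<le> 1 - measure P' ?L"
    using P'.finite_measure_mono[OF L common_objects_event[OF P']] by simp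
  also have "\<dots> = measure P' (space P' - ?L)"
    by (rule P'.prob_compl[symmetric]) (auto simp: ev)
  also have "space P' - ?L = {x \<in> objects K. E x P < E h P}"
    by (auto simp: sp)
  also note dom
  also have "measure P' {h} \<le> tukey_depth K h P'"
    by (rule prob_singleton_le_tukey_depth[OF P' gh(2)])
  finally show ?thesis .
qed

text \<open>The function \<open>f\<close> sends \<open>t\<close> to the largest value of \<open>v\<close> on \<open>{u \<le> t}\<close>. At \<open>t = u g\<close> this
  is \<open>v g\<close>, since an object with a larger value of \<open>v\<close> would also have a larger value of \<open>u\<close>.\<close>

lemma ex_mono_factor:
  fixes u :: "'g \<Rightarrow> 'a::linorder" and v :: "'g \<Rightarrow> 'b::linorder"
  assumes fin: "finite G"
    and refines: "\<And>g h. \<lbrakk>g \<in> G; h \<in> G; v g < v h\<rbrakk> \<Longrightarrow> u g < u h"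
  obtains f where "mono f" and "\<And>g. g \<in> G \<Longrightarrow> f (u g) = v g"
proof
  \<comment> \<open>Below the range of \<open>u\<close> the set \<open>{u \<le> t}\<close> is empty; \<open>Min (v ` G)\<close> is a default value
    that keeps the function monotone there and changes no other value.\<close>
  let ?f = "\<lambda>t. Max (insert (Min (v ` G)) (v ` {g\<in>G. u g \<le> t}))"
  show "mono ?f"
  proof (rule monoI, rule Max_mono)
    fix s t :: 'a assume "s \<le> t"
    then show "insert (Min (v ` G)) (v ` {g\<in>G. u g \<le> s}) \<subseteq> insert (Min (v ` G)) (v ` {g\<in>G. u g \<le> t})"
      by (blast intro: order_trans)
  qed (use fin in simp_all)
  show "?f (u g) = v g" if g: "g \<in> G" for g
  proof (rule Max_eqI)
    fix y assume y: "y \<in> insert (Min (v ` G)) (v ` {h\<in>G. u h \<le> u g})"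
    show "y \<le> v g"
    proof (cases "y = Min (v ` G)")
      case True
      then show ?thesis using fin g by simp
    next
      case False
      then obtain h where "h \<in> G" "u h \<le> u g" "y = v h" using y by auto
      then show ?thesis using refines[OF g] by (meson leD leI)
    qed
  qed (use fin g in simp_all)
qed

theorem theorem9:
  fixes K :: "('g, 'm) formal_context"
  assumes "is_formal_context K" and "finite (objects K)"
  shows "weakly_free K (prob_measures (objects K)) (quasiconcave K) (tukey_depth K)"
  unfolding weakly_free_def
proof (intro conjI ballI allI impI)
  show "depth_function K (tukey_depth K)"
    by (simp add: depth_function_def tukey_depth_nonneg)
  show "quasiconcave K (tukey_depth K)"
    by (rule quasiconcave_tukey_depth)
next
  fix P E
  assume P: "P \<in> prob_measures (objects K)"
    and E: "depth_function K E \<and> quasiconcave K E"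
  have "objects K \<noteq> {}"
    using P prob_space.not_empty[of P] by (auto simp: prob_measures_def)
  obtain P' where P': "P' \<in> prob_measures (objects K)"
    and dom: "\<And>h. h \<in> objects K \<Longrightarrow>
        measure P' {x \<in> objects K. E x P < E h P} < measure P' {h}"
    by (rule ex_dominating_prob_measure[OF assms(2) \<open>objects K \<noteq> {}\<close>, of "\<lambda>x. E x P"]) (rule that)
  have refines: "tukey_depth K g P' < tukey_depth K h P'"
    if "g \<in> objects K" "h \<in> objects K" "E g P < E h P" for g h
    by (rule tukey_depth_refines[OF conjunct2[OF E] P P' dom[OF that(2)] that])
  obtain f :: "real \<Rightarrow> real" where "mono f"
    and f: "\<And>g. g \<in> objects K \<Longrightarrow> f (tukey_depth K g P') = E g P"
    by (rule ex_mono_factor[OF assms(2), of "\<lambda>g. E g P" "\<lambda>g. tukey_depth K g P'"])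
      (rule refines, assumption+, rule that)
  have "isomorphic_on (objects K) (\<lambda>g. f (tukey_depth K g P')) (\<lambda>g. E g P)"
    unfolding isomorphic_on_def
    using bij_betwE[OF bij_betw_the_inv_into[OF bij_betw_id[of "objects K"]]]
    by (intro exI[of _ id]) (simp add: f Pi_iff)
  with P' \<open>mono f\<close> show "\<exists>P'\<in>prob_measures (objects K). \<exists>f :: real \<Rightarrow> real. mono f \<and>
      isomorphic_on (objects K) (\<lambda>g. f (tukey_depth K g P')) (\<lambda>g. E g P)"
    by blast
qed

end
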